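(* Let $L$ be a linear transformation on the polynomials in $m$ (with values in a commutative algebra) such that $$L\left(\binom{m+c+d-1}{c+d}\right)=L\left(\binom{m+c-1}{c}\right)L\left(\binom{m+d-1}{d}\right)$$ for all integers $c,d\geq 0$. Then for all labeled posets $(P,\omega)$ and $(Q,\psi)$, $$L(\Omega_{P\oplus Q,\omega\oplus\psi})=L(\Omega_{P,\omega})\,L(\Omega_{Q,\psi}).$$
   Context: All posets are finite; polynomials in $m$ have coefficients in a field of characteristic $0$ such as $\mathbb Q$, and $\binom{m+c-1}{c}=\frac{m(m+1)\cdots(m+c-1)}{c!}$ as a polynomial in $m$ (equal to $1$ for $c=0$). $L$ is linear over the coefficient field, and products on the right-hand sides are taken in its codomain (for example a polynomial ring). A labeled poset $(P,\omega)$ is a poset $P$ with a bijection $\omega:P\to\{1,\dots,|P|\}$. Its order polynomial $\Omega_{P,\omega}(m)$ is the number of maps $f:P\to\{1,\dots,m\}$ with $f(x)\le f(y)$ whenever $x\le y$, and $f(x)<f(y)$ whenever $x<y$ and $\omega(x)>\omega(y)$; it is a polynomial in $m$. The ordinal sum $P\oplus Q$ is the poset on the disjoint union of $P$ and $Q$ that keeps the relations of $P$ and of $Q$ and adds $x\le y$ for all $x\in P$, $y\in Q$. The labeling $\omega\oplus\psi$ is $(\omega\oplus\psi)(x)=\omega(x)$ for $x\in P$ and $(\omega\oplus\psi)(x)=|P|+\psi(x)$ for $x\in Q$. *)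

theory Defs
  imports
    Complex_Main
    "HOL-Library.FuncSet"
    "HOL-Library.Infinite_Set"
    "HOL-Computational_Algebra.Polynomial"
begin

text \<open>
  A commutative associative algebra over a field. A unit is not required, so unital algebras
  (and the zero algebra, which class \<open>comm_ring_1\<close> would exclude) are all covered.
\<close>

locale commutative_algebra = vector_space scale
  for scale :: "'k::field \<Rightarrow> 'a::comm_ring \<Rightarrow> 'a" +
  assumes scale_mult_left: "scale a x * y = scale a (x * y)"

text \<open>
  The poset with carrier \<open>P\<close> and relation \<open>r\<close>, where \<open>(x, y) \<in> r\<close> means \<open>x \<le> y\<close>; the carrier may
  be empty.
\<close>

definition labeled_poset :: "'p set \<Rightarrow> 'p rel \<Rightarrow> ('p \<Rightarrow> nat) \<Rightarrow> bool" where
  "labeled_poset P r \<omega> \<longleftrightarrow>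
     finite P \<and> partial_order_on P r \<and> bij_betw \<omega> P {1..card P}"

definition labeled_maps :: "'p set \<Rightarrow> 'p rel \<Rightarrow> ('p \<Rightarrow> nat) \<Rightarrow> nat \<Rightarrow> ('p \<Rightarrow> nat) set" where
  "labeled_maps P r \<omega> m =
     {f \<in> P \<rightarrow>\<^sub>E {1..m}.
        (\<forall>(x, y)\<in>r. f x \<le> f y) \<and>
        (\<forall>(x, y)\<in>r. x \<noteq> y \<and> \<omega> x > \<omega> y \<longrightarrow> f x < f y)}"

text \<open>
  Existence and uniqueness of the polynomial are shown in \<open>ex1_order_polynomial\<close> below.
\<close>

definition order_polynomial ::
  "'p set \<Rightarrow> 'p rel \<Rightarrow> ('p \<Rightarrow> nat) \<Rightarrow> 'k::field_char_0 poly" where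
  "order_polynomial P r \<omega> =
     (THE p. \<forall>m. poly p (of_nat m) = of_nat (card (labeled_maps P r \<omega> m)))"

definition ordinal_sum :: "'p set \<Rightarrow> 'p rel \<Rightarrow> 'q set \<Rightarrow> 'q rel \<Rightarrow> ('p + 'q) rel" where
  "ordinal_sum P r Q s =
     map_prod Inl Inl ` r \<union> map_prod Inr Inr ` s \<union> Inl ` P \<times> Inr ` Q"

definition ordinal_sum_labeling ::
  "'p set \<Rightarrow> ('p \<Rightarrow> nat) \<Rightarrow> ('q \<Rightarrow> nat) \<Rightarrow> 'p + 'q \<Rightarrow> nat" where
  "ordinal_sum_labeling P \<omega> \<psi> = case_sum \<omega> (\<lambda>y. card P + \<psi> y)"

text \<open>
  The polynomial \<open>m (m + 1) \<dots> (m + c - 1) / c!\<close>, with \<open>[:0, 1:]\<close> as the variable \<open>m\<close>.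
\<close>

definition multichoose_poly :: "nat \<Rightarrow> 'k::field_char_0 poly" where
  "multichoose_poly c = smult (1 / fact c) (pochhammer [:0, 1:] c)"

lemma poly_multichoose_poly: "poly (multichoose_poly c) x = (x + of_nat c - 1) gchoose c"
proof -
  have "poly (pochhammer [:0, 1:] c) x = pochhammer x c"
    by (simp add: pochhammer_prod poly_prod)
  then show ?thesis
    by (simp add: multichoose_poly_def gbinomial_pochhammer')
qed

lemma labeled_poset_ordinal_sum:
  assumes "labeled_poset P r \<omega>" "labeled_poset Q s \<psi>"
  shows "labeled_poset (P <+> Q) (ordinal_sum P r Q s) (ordinal_sum_labeling P \<omega> \<psi>)"
proof -
  have fin: "finite P" "finite Q"
    and r: "r \<subseteq> P \<times> P" "refl_on P r" "trans r" "antisym r"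
    and s: "s \<subseteq> Q \<times> Q" "refl_on Q s" "trans s" "antisym s"
    and \<omega>: "bij_betw \<omega> P {1..card P}" and \<psi>: "bij_betw \<psi> Q {1..card Q}"
    using assms by (auto simp: labeled_poset_def partial_order_on_def preorder_on_def)
  let ?r = "ordinal_sum P r Q s" and ?l = "ordinal_sum_labeling P \<omega> \<psi>"
  have mem: "(Inl x, Inl y) \<in> ?r \<longleftrightarrow> (x, y) \<in> r" "(Inr u, Inr v) \<in> ?r \<longleftrightarrow> (u, v) \<in> s"
    "(Inl x, Inr v) \<in> ?r \<longleftrightarrow> x \<in> P \<and> v \<in> Q" "(Inr u, Inl y) \<notin> ?r" for x y u v
    by (auto simp: ordinal_sum_def)
  have "?r \<subseteq> (P <+> Q) \<times> (P <+> Q)"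
    using r(1) s(1) by (auto simp: ordinal_sum_def)
  moreover have "refl_on (P <+> Q) ?r"
    using r(2) s(2) by (auto simp: refl_on_def mem)
  moreover have "trans ?r"
  proof (rule transI)
    fix a b c assume "(a, b) \<in> ?r" "(b, c) \<in> ?r"
    moreover have "x \<in> P \<and> y \<in> P" if "(x, y) \<in> r" for x y using that r(1) by blast
    moreover have "x \<in> Q \<and> y \<in> Q" if "(x, y) \<in> s" for x y using that s(1) by blast
    ultimately show "(a, c) \<in> ?r"
      by (cases a; cases b; cases c) (simp_all add: mem, (metis transD r(3) s(3))+)
  qed
  moreover have "antisym ?r"
  proof (rule antisymI)
    fix a b assume "(a, b) \<in> ?r" "(b, a) \<in> ?r"
    then show "a = b"
      using antisymD[OF r(4)] antisymD[OF s(4)] by (cases a; cases b) (auto simp: mem)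
  qed
  moreover have "bij_betw ?l (P <+> Q) {1..card (P <+> Q)}"
  proof -
    have "bij_betw ?l (Inl ` P) {1..card P}"
      using \<omega> by (auto simp: bij_betw_def inj_on_def ordinal_sum_labeling_def image_image)
    moreover have "bij_betw ?l (Inr ` Q) {card P + 1..card P + card Q}"
    proof -
      have "?l ` Inr ` Q = (+) (card P) ` \<psi> ` Q"
        by (simp add: ordinal_sum_labeling_def image_image)
      also have "\<dots> = {card P + 1..card P + card Q}"
        using \<psi> by (simp add: bij_betw_def add.commute)
      finally show ?thesis
        using \<psi> by (auto simp: bij_betw_def inj_on_def ordinal_sum_labeling_def)
    qed
    ultimately have
      "bij_betw ?l (Inl ` P \<union> Inr ` Q) ({1..card P} \<union> {card P + 1..card P + card Q})"
      by (rule bij_betw_combine) auto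
    moreover have "{1..card P} \<union> {card P + 1..card P + card Q} = {1..card (P <+> Q)}"
      using fin by (auto simp: card_Plus)
    ultimately show ?thesis
      by (simp add: Plus_def)
  qed
  ultimately show ?thesis
    using fin by (simp add: labeled_poset_def partial_order_on_def preorder_on_def)
qed

lemma card_labeled_maps_with_image:
  assumes r: "r \<subseteq> P \<times> P" and S: "finite S" "S \<subseteq> {1..m}"
  shows "card {f \<in> labeled_maps P r \<omega> m. f ` P = S} =
         card {f \<in> labeled_maps P r \<omega> (card S). f ` P = {1..card S}}"
proof -
  let ?k = "card S"
  obtain h0 where h0: "bij_betw h0 {..<card S} S" "strict_mono_on {..<card S} h0"
    using ex_bij_betw_strict_mono_card[OF S(1)] by blast
  define h where "h i = h0 (i - 1)" for i
  have img: "(\<lambda>i. i - 1) ` {1..?k} = {..<?k}"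
  proof
    show "{..<?k} \<subseteq> (\<lambda>i. i - 1) ` {1..?k}"
    proof
      fix x assume "x \<in> {..<?k}"
      then show "x \<in> (\<lambda>i. i - 1) ` {1..?k}"
        by (intro image_eqI[of _ _ "Suc x"]) auto
    qed
  qed auto
  have hS: "h ` {1..?k} = S"
    using h0(1) unfolding h_def image_image[of h0 "\<lambda>i. i - 1", symmetric] img
    by (simp add: bij_betw_def)
  have hless: "h i < h j \<longleftrightarrow> i < j" if "i \<in> {1..?k}" "j \<in> {1..?k}" for i j
  proof -
    have "h0 (i - 1) < h0 (j - 1) \<longleftrightarrow> i - 1 < j - 1"
      using strict_mono_on_less[OF h0(2), of "i - 1" "j - 1"] that by auto
    then show ?thesis using that by (auto simp: h_def)
  qed
  have hle: "h i \<le> h j \<longleftrightarrow> i \<le> j" if "i \<in> {1..?k}" "j \<in> {1..?k}" for i j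
    using hless[OF that(2) that(1)] by (simp add: not_less[symmetric])
  have hinj: "inj_on h {1..?k}"
  proof (rule inj_onI)
    fix i j assume "i \<in> {1..?k}" "j \<in> {1..?k}" "h i = h j"
    then show "i = j" using hle[of i j] hle[of j i] by simp
  qed
  define g where "g = inv_into {1..?k} h"
  have gh: "g (h i) = i" if "i \<in> {1..?k}" for i
    using that hinj by (simp add: g_def)
  have hg: "h (g x) = x" "g x \<in> {1..?k}" if "x \<in> S" for x
  proof -
    have "x \<in> h ` {1..?k}" using that hS by blast
    then show "h (g x) = x" "g x \<in> {1..?k}"
      unfolding g_def by (fact f_inv_into_f, fact inv_into_into)
  qed
  have gS: "g ` S = {1..?k}"
  proof -
    have "g ` h ` {1..?k} = (\<lambda>i. i) ` {1..?k}"
      unfolding image_image using gh by (rule image_cong[OF refl])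
    then show ?thesis unfolding hS by simp
  qed
  have gless: "g x < g y \<longleftrightarrow> x < y" and gle: "g x \<le> g y \<longleftrightarrow> x \<le> y" if "x \<in> S" "y \<in> S" for x y
    using hless[OF hg(2) hg(2), OF that] hle[OF hg(2) hg(2), OF that] by (simp_all only: hg(1)[OF that(1)] hg(1)[OF that(2)])
  let ?A = "{f \<in> labeled_maps P r \<omega> m. f ` P = S}"
  let ?B = "{f \<in> labeled_maps P r \<omega> ?k. f ` P = {1..?k}}"
  have "bij_betw (\<lambda>f. restrict (g \<circ> f) P) ?A ?B"
  proof (rule bij_betw_byWitness[where f' = "\<lambda>f. restrict (h \<circ> f) P"])
    show "\<forall>f\<in>?A. restrict (h \<circ> restrict (g \<circ> f) P) P = f"
    proof
      fix f assume f: "f \<in> ?A"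
      then have "f \<in> extensional P" by (auto simp: labeled_maps_def PiE_def)
      moreover have "h (g (f x)) = f x" if "x \<in> P" for x
        using f that hg(1) by blast
      ultimately show "restrict (h \<circ> restrict (g \<circ> f) P) P = f"
        by (intro extensionalityI[of _ P]) auto
    qed
    show "\<forall>f\<in>?B. restrict (g \<circ> restrict (h \<circ> f) P) P = f"
    proof
      fix f assume f: "f \<in> ?B"
      then have "f \<in> extensional P" by (auto simp: labeled_maps_def PiE_def)
      moreover have "g (h (f x)) = f x" if "x \<in> P" for x
        using f that gh by blast
      ultimately show "restrict (g \<circ> restrict (h \<circ> f) P) P = f"
        by (intro extensionalityI[of _ P]) auto
    qed
    show "(\<lambda>f. restrict (g \<circ> f) P) ` ?A \<subseteq> ?B"
    proof (rule image_subsetI)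
      fix f assume f: "f \<in> ?A"
      have fS: "f x \<in> S" if "x \<in> P" for x using f that by blast
      have "restrict (g \<circ> f) P ` P = {1..?k}"
        using f gS image_comp[of g f P] by simp
      moreover have "restrict (g \<circ> f) P \<in> labeled_maps P r \<omega> ?k"
        unfolding labeled_maps_def mem_Collect_eq
      proof (intro conjI ballI; clarify?)
        show "restrict (g \<circ> f) P \<in> P \<rightarrow>\<^sub>E {1..?k}"
          using hg(2) fS by (simp add: PiE_iff del: atLeastAtMost_iff)
      next
        fix x y assume xy: "(x, y) \<in> r"
        then have "x \<in> P" "y \<in> P" using r by auto
        moreover have "f x \<le> f y" using f xy by (auto simp: labeled_maps_def)
        ultimately show "restrict (g \<circ> f) P x \<le> restrict (g \<circ> f) P y"
          using fS by (simp add: gle)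
      next
        fix x y assume xy: "(x, y) \<in> r" "x \<noteq> y" "\<omega> x > \<omega> y"
        then have "x \<in> P" "y \<in> P" using r by auto
        moreover have "f x < f y" using f xy by (auto simp: labeled_maps_def)
        ultimately show "restrict (g \<circ> f) P x < restrict (g \<circ> f) P y"
          using fS by (simp add: gless)
      qed
      ultimately show "restrict (g \<circ> f) P \<in> ?B" by simp
    qed
    show "(\<lambda>f. restrict (h \<circ> f) P) ` ?B \<subseteq> ?A"
    proof (rule image_subsetI)
      fix f assume f: "f \<in> ?B"
      have fS: "f x \<in> {1..?k}" if "x \<in> P" for x using f that by blast
      have hm: "h i \<in> {1..m}" if "i \<in> {1..?k}" for i
        using hS S(2) that by blast
      have "restrict (h \<circ> f) P ` P = S"
        using f hS image_comp[of h f P] by simp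
      moreover have "restrict (h \<circ> f) P \<in> labeled_maps P r \<omega> m"
        unfolding labeled_maps_def mem_Collect_eq
      proof (intro conjI ballI; clarify?)
        show "restrict (h \<circ> f) P \<in> P \<rightarrow>\<^sub>E {1..m}"
          using hm fS by (simp add: PiE_iff del: atLeastAtMost_iff)
      next
        fix x y assume xy: "(x, y) \<in> r"
        then have "x \<in> P" "y \<in> P" using r by auto
        moreover have "f x \<le> f y" using f xy by (auto simp: labeled_maps_def)
        ultimately show "restrict (h \<circ> f) P x \<le> restrict (h \<circ> f) P y"
          using fS by (simp add: hle del: atLeastAtMost_iff)
      next
        fix x y assume xy: "(x, y) \<in> r" "x \<noteq> y" "\<omega> x > \<omega> y"
        then have "x \<in> P" "y \<in> P" using r by auto
        moreover have "f x < f y" using f xy by (auto simp: labeled_maps_def)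
        ultimately show "restrict (h \<circ> f) P x < restrict (h \<circ> f) P y"
          using fS by (simp add: hless del: atLeastAtMost_iff)
      qed
      ultimately show "restrict (h \<circ> f) P \<in> ?A" by simp
    qed
  qed
  then show ?thesis by (rule bij_betw_same_card)
qed

lemma card_labeled_maps:
  assumes "finite P" "r \<subseteq> P \<times> P"
  shows "card (labeled_maps P r \<omega> m) =
    (\<Sum>k\<le>card P. card {f \<in> labeled_maps P r \<omega> k. f ` P = {1..k}} * (m choose k))"
proof -
  let ?N = "\<lambda>k. card {f \<in> labeled_maps P r \<omega> k. f ` P = {1..k}}"
  let ?SS = "\<lambda>k. {S. S \<subseteq> {1..m} \<and> card S = k}"
  let ?M = "{S. S \<subseteq> {1..m} \<and> card S \<le> card P}"
  have fin: "finite (labeled_maps P r \<omega> m)"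
    unfolding labeled_maps_def
    by (rule finite_subset[of _ "P \<rightarrow>\<^sub>E {1..m}"]) (auto simp: assms(1) intro!: finite_PiE)
  have "f ` P \<in> ?M" if "f \<in> labeled_maps P r \<omega> m" for f
    using that card_image_le[OF assms(1), of f] by (auto simp: labeled_maps_def)
  then have "labeled_maps P r \<omega> m = (\<Union>S\<in>?M. {f \<in> labeled_maps P r \<omega> m. f ` P = S})"
    by blast
  then have "card (labeled_maps P r \<omega> m) =
      card (\<Union>S\<in>?M. {f \<in> labeled_maps P r \<omega> m. f ` P = S})"
    by simp
  also have "\<dots> = (\<Sum>S\<in>?M. card {f \<in> labeled_maps P r \<omega> m. f ` P = S})"
    using fin by (intro card_UN_disjoint) auto
  also have "\<dots> = (\<Sum>S\<in>?M. ?N (card S))"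
  proof (rule sum.cong)
    fix S assume "S \<in> ?M"
    then have "finite S" "S \<subseteq> {1..m}" using finite_subset[of S "{1..m}"] by auto
    then show "card {f \<in> labeled_maps P r \<omega> m. f ` P = S} = ?N (card S)"
      by (rule card_labeled_maps_with_image[OF assms(2)])
  qed simp
  also have "\<dots> = (\<Sum>k\<le>card P. \<Sum>S\<in>{S \<in> ?M. card S = k}. ?N (card S))"
    by (intro sum.group[symmetric]) auto
  also have "\<dots> = (\<Sum>k\<le>card P. ?N k * (m choose k))"
  proof (rule sum.cong)
    fix k assume "k \<in> {..card P}"
    then have "{S \<in> ?M. card S = k} = ?SS k" by auto
    moreover have "(\<Sum>S\<in>?SS k. ?N (card S)) = (\<Sum>S\<in>?SS k. ?N k)"
      by (rule sum.cong) auto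
    ultimately show "(\<Sum>S\<in>{S \<in> ?M. card S = k}. ?N (card S)) = ?N k * (m choose k)"
      by (simp add: n_subsets)
  qed simp
  finally show ?thesis .
qed

lemma ex1_order_polynomial:
  assumes "finite P" "r \<subseteq> P \<times> P"
  shows "\<exists>!p :: 'k::field_char_0 poly.
    \<forall>m. poly p (of_nat m) = of_nat (card (labeled_maps P r \<omega> m))"
proof (rule ex_ex1I)
  let ?N = "\<lambda>k. card {f \<in> labeled_maps P r \<omega> k. f ` P = {1..k}}"
  define B :: "nat \<Rightarrow> 'k poly"
    where "B k = smult (1 / fact k) (\<Prod>i = 0..<k. [:- of_nat i, 1:])" for k
  have B: "poly (B k) (of_nat m) = of_nat (m choose k)" for k m
    by (simp add: B_def poly_prod binomial_gbinomial gbinomial_prod_rev)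
  have "poly (\<Sum>k\<le>card P. smult (of_nat (?N k)) (B k)) (of_nat m) =
      of_nat (card (labeled_maps P r \<omega> m))" for m
    unfolding card_labeled_maps[OF assms] by (simp add: poly_sum B)
  then show "\<exists>p :: 'k poly. \<forall>m. poly p (of_nat m) = of_nat (card (labeled_maps P r \<omega> m))"
    by blast
next
  fix p q :: "'k poly"
  assume "\<forall>m. poly p (of_nat m) = of_nat (card (labeled_maps P r \<omega> m))"
    and "\<forall>m. poly q (of_nat m) = of_nat (card (labeled_maps P r \<omega> m))"
  then have "range of_nat \<subseteq> {x. poly (p - q) x = 0}" by auto
  moreover have "infinite (range of_nat :: 'k set)"
    by (simp add: finite_image_iff inj_of_nat)
  ultimately show "p = q"
    using poly_roots_finite[of "p - q"] finite_subset by auto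
qed

lemma poly_order_polynomial:
  assumes "labeled_poset P r \<omega>"
  shows "poly (order_polynomial P r \<omega> :: 'k::field_char_0 poly) (of_nat m) =
    of_nat (card (labeled_maps P r \<omega> m))"
proof -
  have "finite P" "r \<subseteq> P \<times> P"
    using assms by (auto simp: labeled_poset_def partial_order_on_def preorder_on_def)
  from theI'[OF ex1_order_polynomial[OF this, where 'k = 'k]] show ?thesis
    unfolding order_polynomial_def by blast
qed

end

theory Submission
  imports Defs "HOL-Computational_Algebra.Formal_Power_Series"
begin

text \<open>
  Encode a polynomial \<open>p\<close> by the power series \<open>F p = (\<Sum>n. p (n + 1) X^n)\<close> of its values at the
  positive integers. Both the rule that \<open>L\<close> satisfies on the \<open>e\<^sub>c = multichoose_poly c\<close> and the
  counting of maps on an ordinal sum then become the multiplication \<open>(1 - X) F p F q\<close>.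

  On the algebraic side, iterating Pascal's rule gives \<open>F e\<^sub>c = 1 / (1 - X)^(c + 1)\<close>,
  so \<open>F e\<^sub>(\<^sub>c\<^sub>+\<^sub>d\<^sub>) = (1 - X) F e\<^sub>c F e\<^sub>d\<close>. The \<open>e\<^sub>c\<close> span all polynomials,
  hence the hypothesis on \<open>L\<close> says by bilinearity that \<open>L u = L p * L q\<close> whenever
  \<open>F u = (1 - X) F p F q\<close>.

  On the combinatorial side, a map on an ordinal sum is a map on \<open>P\<close> together with a map on \<open>Q\<close>
  whose values lie weakly above those on \<open>P\<close>; the shift of the labels of \<open>Q\<close> means that no strict
  inequality is imposed between the two parts. Sorting these maps by the least value \<open>j\<close> on \<open>Q\<close>
  (the largest permitted value \<open>m\<close> if \<open>Q\<close> is empty), the restriction to \<open>P\<close> is any map with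
  values up to \<open>j\<close>, while the restriction to \<open>Q\<close> is a map with values from \<open>j\<close> on that, unless
  \<open>j = m\<close>, does not have all its values from \<open>j + 1\<close> on. This gives a difference of two
  convolutions of order polynomials, which is exactly the identity \<open>F u = (1 - X) F p F q\<close> for
  the three order polynomials.
\<close>

section \<open>Spanning by the multichoose polynomials\<close>

text \<open>
  Solving \<open>e\<^sub>(\<^sub>c\<^sub>+\<^sub>1\<^sub>) = e\<^sub>c (m + c) / (c + 1)\<close> for \<open>m e\<^sub>c\<close> shows that the span of the \<open>e\<^sub>c\<close> is stable
  under multiplication by the variable.
\<close>

lemma var_times_multichoose_poly:
  "[:0, 1:] * multichoose_poly c =
     smult (of_nat (Suc c)) (multichoose_poly (Suc c)) +
     smult (- of_nat c) (multichoose_poly c :: 'k::field_char_0 poly)"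
proof -
  have "smult (of_nat (Suc c)) (multichoose_poly (Suc c)) =
      (multichoose_poly c :: 'k poly) * ([:0, 1:] + of_nat c)"
    by (simp add: multichoose_poly_def pochhammer_Suc del: of_nat_Suc)
  then show ?thesis
    by (simp add: of_nat_poly algebra_simps)
qed

lemma multichoose_poly_0 [simp]: "multichoose_poly 0 = 1"
  by (simp add: multichoose_poly_def)

lemma multichoose_poly_induct [case_names add smult base]:
  fixes p :: "'k::field_char_0 poly"
  assumes add: "\<And>p q. A p \<Longrightarrow> A q \<Longrightarrow> A (p + q)"
    and smult: "\<And>a p. A p \<Longrightarrow> A (smult a p)"
    and base: "\<And>c. A (multichoose_poly c)"
  shows "A p"
proof -
  have *: "A ([:0, 1:] ^ n * multichoose_poly c)" for n c
  proof (induction n arbitrary: c)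
    case 0
    show ?case using base by simp
  next
    case (Suc n)
    have "[:0, 1:] ^ Suc n * multichoose_poly c =
        [:0, 1:] ^ n * ([:0, 1:] * multichoose_poly c :: 'k poly)"
      by (simp only: power_Suc2 mult.assoc)
    also have "\<dots> = smult (of_nat (Suc c)) ([:0, 1:] ^ n * multichoose_poly (Suc c)) +
        smult (- of_nat c) ([:0, 1:] ^ n * multichoose_poly c)"
      by (simp only: var_times_multichoose_poly distrib_left mult_smult_right)
    finally show ?case
      using add smult Suc.IH by metis
  qed
  have "A ([:0, 1:] ^ n * p)" for n
  proof (induction p arbitrary: n)
    case 0
    show ?case using smult[OF base, of 0] by simp
  next
    case (pCons a p)
    have "[:0, 1:] ^ n * pCons a p = smult a ([:0, 1:] ^ n * multichoose_poly 0) + [:0, 1:] ^ Suc n * p"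
      by (simp add: algebra_simps)
    then show ?case
      using add smult * pCons.IH by metis
  qed
  from this[of 0] show ?thesis by simp
qed

section \<open>The generating function of values\<close>

unbundle fps_syntax

text \<open>
  The values start at \<open>1\<close> because only then does the constant polynomial \<open>e\<^sub>0\<close> fit the formula for
  \<open>F e\<^sub>c\<close>: it is the one \<open>e\<^sub>c\<close> that does not vanish at \<open>0\<close>.
\<close>

definition value_fps :: "'k::field_char_0 poly \<Rightarrow> 'k fps" where
  "value_fps p = Abs_fps (\<lambda>n. poly p (of_nat (Suc n)))"

lemma value_fps_nth [simp]: "value_fps p $ n = poly p (of_nat (Suc n))"
  by (simp add: value_fps_def)

lemma value_fps_add: "value_fps (p + q) = value_fps p + value_fps q"
  by (simp add: fps_eq_iff)

lemma value_fps_smult: "value_fps (smult a p) = fps_const a * value_fps p"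
  by (simp add: fps_eq_iff)

lemma value_fps_inject:
  assumes "value_fps p = value_fps q"
  shows "p = q"
proof (rule ccontr)
  assume "p \<noteq> q"
  then have "finite {x. poly (p - q) x = 0}"
    by (intro poly_roots_finite) simp
  moreover have "range (\<lambda>n. of_nat (Suc n)) \<subseteq> {x. poly (p - q) x = 0}"
    using assms by (auto simp: fps_eq_iff simp del: of_nat_Suc)
  moreover have "infinite (range (\<lambda>n. of_nat (Suc n) :: 'a))"
    by (rule range_inj_infinite) (simp add: inj_def del: of_nat_Suc)
  ultimately show False
    using finite_subset by blast
qed

lemma one_minus_X_times_value_fps_multichoose_Suc:
  "(1 - fps_X) * value_fps (multichoose_poly (Suc c)) =
     value_fps (multichoose_poly c :: 'k::field_char_0 poly)"
proof (rule fps_ext)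
  fix n
  show "((1 - fps_X) * value_fps (multichoose_poly (Suc c))) $ n =
      value_fps (multichoose_poly c :: 'k poly) $ n"
  proof (cases n)
    case 0
    have "(of_nat (Suc c) :: 'k) gchoose Suc c = 1" "(of_nat c :: 'k) gchoose c = 1"
      by (simp_all only: binomial_gbinomial[symmetric] binomial_n_n of_nat_1)
    then show ?thesis
      using 0 by (simp add: algebra_simps poly_multichoose_poly)
  next
    case (Suc i)
    have "(of_nat (Suc i + c) + 1 :: 'k) gchoose Suc c =
        (of_nat (Suc i + c) gchoose c) + (of_nat (Suc i + c) gchoose Suc c)"
      by (rule gbinomial_Suc_Suc)
    then show ?thesis
      using Suc by (simp add: algebra_simps poly_multichoose_poly)
  qed
qed

lemma value_fps_multichoose_poly:
  "(1 - fps_X) ^ Suc c * value_fps (multichoose_poly c :: 'k::field_char_0 poly) = 1"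
proof (induction c)
  case 0
  show ?case
    by (rule fps_ext) (simp add: algebra_simps)
next
  case (Suc c)
  then show ?case
    using one_minus_X_times_value_fps_multichoose_Suc[of c, where 'k = 'k]
    by (simp only: power_Suc2 mult.assoc)
qed

lemma value_fps_multichoose_poly_add:
  "value_fps (multichoose_poly (c + d)) =
     (1 - fps_X) * value_fps (multichoose_poly c) *
       value_fps (multichoose_poly d :: 'k::field_char_0 poly)"
proof -
  let ?F = "\<lambda>c. value_fps (multichoose_poly c :: 'k poly)" and ?Y = "1 - fps_X :: 'k fps"
  have "?F (c + d) = ?F (c + d) * (?Y ^ Suc c * ?F c) * (?Y ^ Suc d * ?F d)"
    by (simp only: value_fps_multichoose_poly mult_1_right)
  also have "\<dots> = (?Y ^ Suc (c + d) * ?F (c + d)) * (?Y * ?F c * ?F d)"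
    by (simp add: power_add algebra_simps)
  finally show ?thesis
    by (simp only: value_fps_multichoose_poly mult_1_left)
qed

text \<open>
  The condition on \<open>u\<close> determines \<open>u\<close> and is bilinear in \<open>p\<close> and \<open>q\<close>, as is the conclusion, so it
  suffices to treat \<open>p = e\<^sub>c\<close> and \<open>q = e\<^sub>d\<close>, where \<open>u = e\<^sub>(\<^sub>c\<^sub>+\<^sub>d\<^sub>)\<close>. The existence of a \<open>u\<close> for arbitrary
  \<open>p\<close> and \<open>q\<close> is part of what the induction establishes.
\<close>

lemma linear_of_value_fps_product:
  fixes scale :: "'k::field_char_0 \<Rightarrow> 'a::comm_ring \<Rightarrow> 'a"
  assumes alg: "commutative_algebra scale"
    and lin: "Vector_Spaces.linear smult scale L"
    and mult: "\<And>c d. L (multichoose_poly (c + d)) = L (multichoose_poly c) * L (multichoose_poly d)"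
    and u: "value_fps u = (1 - fps_X) * value_fps p * value_fps q"
  shows "L u = L p * L q"
proof -
  interpret commutative_algebra scale by fact
  interpret L: Vector_Spaces.linear smult scale L by fact
  have scale_mult_right: "x * scale a y = scale a (x * y)" for a x y
    using scale_mult_left[of a y x] by (simp add: mult.commute)
  define A where "A p q \<longleftrightarrow>
    (\<exists>u. value_fps u = (1 - fps_X) * value_fps p * value_fps q \<and> L u = L p * L q)" for p q
  have "A p q"
  proof (induction p rule: multichoose_poly_induct)
    case (add p p')
    then obtain u u' where
      "value_fps u = (1 - fps_X) * value_fps p * value_fps q" "L u = L p * L q"
      "value_fps u' = (1 - fps_X) * value_fps p' * value_fps q" "L u' = L p' * L q"
      unfolding A_def by blast
    then show ?case
      unfolding A_def by (intro exI[of _ "u + u'"]) (simp add: value_fps_add L.add distrib_left distrib_right)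
  next
    case (smult a p)
    then obtain u where
      "value_fps u = (1 - fps_X) * value_fps p * value_fps q" "L u = L p * L q"
      unfolding A_def by blast
    then show ?case
      unfolding A_def
      by (intro exI[of _ "smult a u"])
         (simp add: value_fps_smult L.scale scale_mult_left scale_mult_right mult_ac)
  next
    case (base c)
    show ?case
    proof (induction q rule: multichoose_poly_induct)
      case (add q q')
      then obtain u u' where
        "value_fps u = (1 - fps_X) * value_fps (multichoose_poly c) * value_fps q"
        "L u = L (multichoose_poly c) * L q"
        "value_fps u' = (1 - fps_X) * value_fps (multichoose_poly c) * value_fps q'"
        "L u' = L (multichoose_poly c) * L q'"
        unfolding A_def by blast
      then show ?case
        unfolding A_def by (intro exI[of _ "u + u'"]) (simp add: value_fps_add L.add distrib_left distrib_right)
    next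
      case (smult a q)
      then obtain u where
        "value_fps u = (1 - fps_X) * value_fps (multichoose_poly c) * value_fps q"
        "L u = L (multichoose_poly c) * L q"
        unfolding A_def by blast
      then show ?case
        unfolding A_def
        by (intro exI[of _ "smult a u"])
           (simp add: value_fps_smult L.scale scale_mult_left scale_mult_right mult_ac)
    next
      case (base d)
      show ?case
        unfolding A_def using value_fps_multichoose_poly_add mult by blast
    qed
  qed
  then show ?thesis
    using u value_fps_inject unfolding A_def by metis
qed

section \<open>Counting maps on an ordinal sum\<close>

text \<open>
  Once the values on \<open>P\<close> are confined to \<open>{1..j}\<close> and those on \<open>Q\<close> to \<open>{k+1..m}\<close>, with
  \<open>j \<le> k + 1\<close>, the relations between \<open>P\<close> and \<open>Q\<close> hold automatically and the two restrictions can
  be chosen independently.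
\<close>

lemma card_labeled_maps_ordinal_sum_separated:
  assumes r: "r \<subseteq> P \<times> P" and s: "s \<subseteq> Q \<times> Q"
    and \<omega>: "\<And>x. x \<in> P \<Longrightarrow> \<omega> x \<le> card P"
    and j: "j \<le> Suc k" "j \<le> m"
  shows "card {f \<in> labeled_maps (P <+> Q) (ordinal_sum P r Q s) (ordinal_sum_labeling P \<omega> \<psi>) m.
           (\<forall>x\<in>P. f (Inl x) \<le> j) \<and> (\<forall>y\<in>Q. k < f (Inr y))} =
         card (labeled_maps P r \<omega> j) * card (labeled_maps Q s \<psi> (m - k))"
    (is "card ?A = _")
proof -
  let ?F = "\<lambda>f. (\<lambda>x\<in>P. f (Inl x), \<lambda>y\<in>Q. f (Inr y) - k)"
  let ?G = "\<lambda>(g, h). \<lambda>z\<in>P <+> Q. case_sum g (\<lambda>y. h y + k) z"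
  let ?B = "labeled_maps P r \<omega> j \<times> labeled_maps Q s \<psi> (m - k)"
  have rP: "x \<in> P" "y \<in> P" if "(x, y) \<in> r" for x y using that r by auto
  have sQ: "x \<in> Q" "y \<in> Q" if "(x, y) \<in> s" for x y using that s by auto
  have "bij_betw ?F ?A ?B"
  proof (rule bij_betw_byWitness[where f' = ?G])
    show "\<forall>f\<in>?A. ?G (?F f) = f"
    proof
      fix f assume f: "f \<in> ?A"
      show "?G (?F f) = f"
      proof (rule extensionalityI[of _ "P <+> Q"])
        show "f \<in> extensional (P <+> Q)"
          using f by (auto simp: labeled_maps_def PiE_def)
      next
        fix z assume "z \<in> P <+> Q"
        then show "?G (?F f) z = f z"
          using f by (cases z) (auto simp: less_imp_le)
      qed auto
    qed
    show "\<forall>gh\<in>?B. ?F (?G gh) = gh"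
    proof
      fix gh assume "gh \<in> ?B"
      then obtain g h where gh: "gh = (g, h)" "g \<in> extensional P" "h \<in> extensional Q"
        by (auto simp: labeled_maps_def PiE_def)
      then show "?F (?G gh) = gh"
        by (auto intro!: extensionalityI[of _ P] extensionalityI[of _ Q])
    qed
    show "?F ` ?A \<subseteq> ?B"
    proof (rule image_subsetI)
      fix f assume f: "f \<in> ?A"
      have fP: "f (Inl x) \<in> {1..j}" if "x \<in> P" for x
        using f that by (auto simp: labeled_maps_def PiE_iff)
      have fQ: "f (Inr y) - k \<in> {1..m - k}" "k < f (Inr y)" if "y \<in> Q" for y
      proof -
        have "f (Inr y) \<in> {1..m}" "k < f (Inr y)"
          using f that by (auto simp: labeled_maps_def PiE_iff)
        then show "f (Inr y) - k \<in> {1..m - k}" "k < f (Inr y)"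
          by auto
      qed
      have fle: "f a \<le> f b" if "(a, b) \<in> ordinal_sum P r Q s" for a b
        using f that by (auto simp: labeled_maps_def)
      have fless: "f a < f b" if "(a, b) \<in> ordinal_sum P r Q s" "a \<noteq> b"
        "ordinal_sum_labeling P \<omega> \<psi> b < ordinal_sum_labeling P \<omega> \<psi> a" for a b
        using f that by (auto simp: labeled_maps_def)
      have "(\<lambda>x\<in>P. f (Inl x)) \<in> labeled_maps P r \<omega> j"
        unfolding labeled_maps_def mem_Collect_eq
      proof (intro conjI ballI; clarify?)
        show "(\<lambda>x\<in>P. f (Inl x)) \<in> P \<rightarrow>\<^sub>E {1..j}"
          using fP by (simp add: PiE_iff del: atLeastAtMost_iff)
      next
        fix x y assume xy: "(x, y) \<in> r"
        then have "(Inl x, Inl y) \<in> ordinal_sum P r Q s"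
          by (auto simp: ordinal_sum_def)
        then show "(\<lambda>x\<in>P. f (Inl x)) x \<le> (\<lambda>x\<in>P. f (Inl x)) y"
          using fle rP[OF xy] by simp
      next
        fix x y assume xy: "(x, y) \<in> r" "x \<noteq> y" "\<omega> x > \<omega> y"
        then have "(Inl x, Inl y) \<in> ordinal_sum P r Q s"
          by (auto simp: ordinal_sum_def)
        then show "(\<lambda>x\<in>P. f (Inl x)) x < (\<lambda>x\<in>P. f (Inl x)) y"
          using fless[of "Inl x" "Inl y"] xy rP[OF xy(1)] by (simp add: ordinal_sum_labeling_def)
      qed
      moreover have "(\<lambda>y\<in>Q. f (Inr y) - k) \<in> labeled_maps Q s \<psi> (m - k)"
        unfolding labeled_maps_def mem_Collect_eq
      proof (intro conjI ballI; clarify?)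
        show "(\<lambda>y\<in>Q. f (Inr y) - k) \<in> Q \<rightarrow>\<^sub>E {1..m - k}"
          using fQ by (simp add: PiE_iff del: atLeastAtMost_iff)
      next
        fix x y assume xy: "(x, y) \<in> s"
        then have "(Inr x, Inr y) \<in> ordinal_sum P r Q s"
          by (auto simp: ordinal_sum_def)
        then show "(\<lambda>y\<in>Q. f (Inr y) - k) x \<le> (\<lambda>y\<in>Q. f (Inr y) - k) y"
          using fle[of "Inr x" "Inr y"] sQ[OF xy] by (simp add: diff_le_mono)
      next
        fix x y assume xy: "(x, y) \<in> s" "x \<noteq> y" "\<psi> x > \<psi> y"
        then have "(Inr x, Inr y) \<in> ordinal_sum P r Q s"
          by (auto simp: ordinal_sum_def)
        then show "(\<lambda>y\<in>Q. f (Inr y) - k) x < (\<lambda>y\<in>Q. f (Inr y) - k) y"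
          using fless[of "Inr x" "Inr y"] xy sQ[OF xy(1)] fQ(2)[of x]
          by (simp add: ordinal_sum_labeling_def diff_less_mono)
      qed
      ultimately show "?F f \<in> ?B" by simp
    qed
    show "?G ` ?B \<subseteq> ?A"
    proof (rule image_subsetI)
      fix gh assume "gh \<in> ?B"
      then obtain g h where gh: "gh = (g, h)"
        and g: "g \<in> labeled_maps P r \<omega> j" and h: "h \<in> labeled_maps Q s \<psi> (m - k)"
        by auto
      let ?f = "?G (g, h)"
      have gP: "1 \<le> g x \<and> g x \<le> j" if "x \<in> P" for x
        using g that by (auto simp: labeled_maps_def PiE_iff)
      have hQ: "1 \<le> h y \<and> h y + k \<le> m" if "y \<in> Q" for y
      proof -
        have "1 \<le> h y \<and> h y \<le> m - k"
          using h that by (auto simp: labeled_maps_def PiE_iff)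
        then show ?thesis by linarith
      qed
      have gle: "g x \<le> g y" and gless: "x \<noteq> y \<Longrightarrow> \<omega> y < \<omega> x \<Longrightarrow> g x < g y" if "(x, y) \<in> r" for x y
        using g that by (auto simp: labeled_maps_def)
      have hle: "h x \<le> h y" and hless: "x \<noteq> y \<Longrightarrow> \<psi> y < \<psi> x \<Longrightarrow> h x < h y" if "(x, y) \<in> s" for x y
        using h that by (auto simp: labeled_maps_def)
      have "?f \<in> P <+> Q \<rightarrow>\<^sub>E {1..m}"
        using gP hQ j(2) by (fastforce simp: PiE_iff)
      moreover have "?f a \<le> ?f b" if "(a, b) \<in> ordinal_sum P r Q s" for a b
      proof -
        from that consider x y where "a = Inl x" "b = Inl y" "(x, y) \<in> r"
          | x y where "a = Inr x" "b = Inr y" "(x, y) \<in> s"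
          | x y where "a = Inl x" "b = Inr y" "x \<in> P" "y \<in> Q"
          by (auto simp: ordinal_sum_def)
        then show "?f a \<le> ?f b"
        proof cases
          case 1
          then show ?thesis using gle rP by (simp add: InlI)
        next
          case 2
          then show ?thesis using hle sQ by (simp add: InrI)
        next
          case 3
          then show ?thesis using gP[of x] hQ[of y] j(1) by (simp add: InlI InrI)
        qed
      qed
      moreover have "?f a < ?f b" if ab: "(a, b) \<in> ordinal_sum P r Q s" "a \<noteq> b"
        and l: "ordinal_sum_labeling P \<omega> \<psi> b < ordinal_sum_labeling P \<omega> \<psi> a" for a b
      proof -
        from ab consider x y where "a = Inl x" "b = Inl y" "(x, y) \<in> r" "x \<noteq> y"
          | x y where "a = Inr x" "b = Inr y" "(x, y) \<in> s" "x \<noteq> y"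
          | x y where "a = Inl x" "b = Inr y" "x \<in> P" "y \<in> Q"
          by (auto simp: ordinal_sum_def)
        then show "?f a < ?f b"
        proof cases
          case 1
          then show ?thesis using gless l rP by (simp add: InlI ordinal_sum_labeling_def)
        next
          case 2
          then show ?thesis using hless l sQ by (simp add: InrI ordinal_sum_labeling_def)
        next
          case 3
          \<comment> \<open>No strict condition arises here: the labels on \<open>Q\<close> exceed those on \<open>P\<close>.\<close>
          then show ?thesis using \<omega>[of x] l by (simp add: ordinal_sum_labeling_def)
        qed
      qed
      ultimately have "?f \<in> labeled_maps (P <+> Q) (ordinal_sum P r Q s) (ordinal_sum_labeling P \<omega> \<psi>) m"
        unfolding labeled_maps_def by blast
      moreover have "\<forall>x\<in>P. ?f (Inl x) \<le> j" "\<forall>y\<in>Q. k < ?f (Inr y)"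
        using gP hQ by fastforce+
      ultimately show "?G gh \<in> ?A"
        using gh by simp
    qed
  qed
  then show ?thesis
    by (simp add: bij_betw_same_card card_cartesian_product)
qed

text \<open>
  The sum on the right counts the pairs of a map and a cut \<open>j\<close> with all values on \<open>P\<close> at most \<open>j\<close>
  and all values on \<open>Q\<close> at least \<open>j\<close>; the sum on the left counts the pairs with the values on \<open>Q\<close>
  even above \<open>j\<close>, for \<open>j < m\<close>. For a given map the cuts of the first kind form an interval, and those
  of the second kind are all of them except the last, so exactly one cut per map is left over. If \<open>Q\<close>
  is empty the last cut is \<open>m\<close>, which the second sum leaves out for this reason.
\<close>

lemma card_labeled_maps_ordinal_sum:
  assumes P: "labeled_poset P r \<omega>" and Q: "labeled_poset Q s \<psi>"
  shows "card (labeled_maps (P <+> Q) (ordinal_sum P r Q s) (ordinal_sum_labeling P \<omega> \<psi>) (Suc n)) +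
      (\<Sum>i<n. card (labeled_maps P r \<omega> (Suc i)) * card (labeled_maps Q s \<psi> (n - i))) =
      (\<Sum>i\<le>n. card (labeled_maps P r \<omega> (Suc i)) * card (labeled_maps Q s \<psi> (Suc n - i)))"
proof -
  let ?M = "labeled_maps (P <+> Q) (ordinal_sum P r Q s) (ordinal_sum_labeling P \<omega> \<psi>) (Suc n)"
  define A where "A j k = {f \<in> ?M. (\<forall>x\<in>P. f (Inl x) \<le> j) \<and> (\<forall>y\<in>Q. k < f (Inr y))}" for j k
  \<comment> \<open>The maps whose last cut is \<open>Suc i\<close>.\<close>
  define D where "D i = A (Suc i) i - (if i < n then A (Suc i) (Suc i) else {})" for i
  have fin: "finite P" "finite Q" and r: "r \<subseteq> P \<times> P" and s: "s \<subseteq> Q \<times> Q"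
    and bij: "bij_betw \<omega> P {1..card P}"
    using P Q by (auto simp: labeled_poset_def partial_order_on_def preorder_on_def)
  have \<omega>: "\<omega> x \<le> card P" if "x \<in> P" for x
    using bij_betwE[OF bij] that by simp
  have card_A: "card (A j k) = card (labeled_maps P r \<omega> j) * card (labeled_maps Q s \<psi> (Suc n - k))"
    if "j \<le> Suc k" "j \<le> Suc n" for j k
    unfolding A_def by (rule card_labeled_maps_ordinal_sum_separated[OF r s \<omega> that])
  have finM: "finite ?M"
    unfolding labeled_maps_def
    by (rule finite_subset[of _ "(P <+> Q) \<rightarrow>\<^sub>E {1..Suc n}"]) (auto simp: fin intro!: finite_PiE)
  then have finA: "finite (A j k)" for j k
    by (simp add: A_def)
  have card_D: "card (D i) + (if i < n then card (A (Suc i) (Suc i)) else 0) = card (A (Suc i) i)" for i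
  proof -
    have sub: "A (Suc i) (Suc i) \<subseteq> A (Suc i) i"
      by (auto simp: A_def)
    show ?thesis
      using card_mono[OF finA sub] card_Diff_subset[OF finA sub] by (simp add: D_def)
  qed
  have rangeP: "f (Inl x) \<in> {1..Suc n}" if "f \<in> ?M" "x \<in> P" for f x
    using that by (auto simp: labeled_maps_def PiE_iff)
  have rangeQ: "f (Inr y) \<in> {1..Suc n}" if "f \<in> ?M" "y \<in> Q" for f y
    using that by (auto simp: labeled_maps_def PiE_iff)
  have below: "f (Inl x) \<le> f (Inr y)" if "f \<in> ?M" "x \<in> P" "y \<in> Q" for f x y
    using that by (auto simp: labeled_maps_def ordinal_sum_def)
  have D_iff: "f \<in> D i \<longleftrightarrow> f \<in> ?M \<and> Suc i = Min (insert (Suc n) ((f \<circ> Inr) ` Q))" if "i \<le> n" for f i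
  proof (cases "f \<in> ?M")
    case True
    let ?S = "insert (Suc n) ((f \<circ> Inr) ` Q)"
    have finS: "finite ?S" using fin by simp
    have eq: "Suc i = Min ?S \<longleftrightarrow> (\<forall>y\<in>Q. i < f (Inr y)) \<and> (i < n \<longrightarrow> \<not> (\<forall>y\<in>Q. Suc i < f (Inr y)))"
    proof -
      have "Suc i = Min ?S \<longleftrightarrow> Suc i \<le> Min ?S \<and> \<not> Suc (Suc i) \<le> Min ?S"
        by linarith
      also have "\<dots> \<longleftrightarrow> (\<forall>a\<in>?S. Suc i \<le> a) \<and> \<not> (\<forall>a\<in>?S. Suc (Suc i) \<le> a)"
        using finS by (simp only: Min_ge_iff insert_not_empty not_False_eq_True)
      also have "\<dots> \<longleftrightarrow> (\<forall>y\<in>Q. i < f (Inr y)) \<and> (i < n \<longrightarrow> \<not> (\<forall>y\<in>Q. Suc i < f (Inr y)))"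
        using that by (auto simp: Suc_le_eq)
      finally show ?thesis .
    qed
    have low: "f (Inl x) \<le> Suc i" if "Suc i = Min ?S" "x \<in> P" for x
    proof -
      have "Suc i \<in> ?S" using Min_in[OF finS] that(1) by simp
      then show ?thesis using rangeP[OF True that(2)] below[OF True that(2)] by auto
    qed
    have "f \<in> D i \<longleftrightarrow> (\<forall>x\<in>P. f (Inl x) \<le> Suc i) \<and>
        (\<forall>y\<in>Q. i < f (Inr y)) \<and> (i < n \<longrightarrow> \<not> (\<forall>y\<in>Q. Suc i < f (Inr y)))"
      using True by (auto simp: D_def A_def)
    then show ?thesis
      using True low eq by blast
  qed (simp add: D_def A_def)
  have "?M = (\<Union>i\<le>n. D i)"
  proof (intro equalityI subsetI)
    fix f assume f: "f \<in> ?M"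
    let ?S = "insert (Suc n) ((f \<circ> Inr) ` Q)"
    have finS: "finite ?S" using fin by simp
    have "Min ?S \<in> ?S" using Min_in[OF finS] by simp
    then have "1 \<le> Min ?S" "Min ?S \<le> Suc n"
      using rangeQ[OF f] by auto
    then obtain i where "Suc i = Min ?S" "i \<le> n"
      by (metis One_nat_def Suc_le_D Suc_le_mono)
    then show "f \<in> (\<Union>i\<le>n. D i)"
      using f D_iff by blast
  qed (auto simp: D_def A_def)
  moreover have "card (\<Union>i\<le>n. D i) = (\<Sum>i\<le>n. card (D i))"
  proof (rule card_UN_disjoint)
    show "\<forall>i\<in>{..n}. finite (D i)" using finA by (simp add: D_def)
    show "\<forall>i\<in>{..n}. \<forall>j\<in>{..n}. i \<noteq> j \<longrightarrow> D i \<inter> D j = {}"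
      using D_iff by (metis Suc_inject atMost_iff disjoint_iff)
  qed simp
  moreover have "(\<Sum>i<n. card (A (Suc i) (Suc i))) = (\<Sum>i\<le>n. if i < n then card (A (Suc i) (Suc i)) else 0)"
    by (rule sum.mono_neutral_cong_left) auto
  ultimately have "card ?M + (\<Sum>i<n. card (A (Suc i) (Suc i))) = (\<Sum>i\<le>n. card (A (Suc i) i))"
    by (simp add: card_D sum.distrib[symmetric])
  moreover have "(\<Sum>i<n. card (A (Suc i) (Suc i))) =
      (\<Sum>i<n. card (labeled_maps P r \<omega> (Suc i)) * card (labeled_maps Q s \<psi> (n - i)))"
    by (rule sum.cong) (simp_all add: card_A)
  moreover have "(\<Sum>i\<le>n. card (A (Suc i) i)) =
      (\<Sum>i\<le>n. card (labeled_maps P r \<omega> (Suc i)) * card (labeled_maps Q s \<psi> (Suc n - i)))"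
    by (rule sum.cong) (simp_all add: card_A)
  ultimately show ?thesis by simp
qed

text \<open>
  This is the preceding count, read coefficientwise: the factor \<open>1 - X\<close> subtracts from the
  convolution of the values its own shift.
\<close>

lemma value_fps_order_polynomial_ordinal_sum:
  assumes P: "labeled_poset P r \<omega>" and Q: "labeled_poset Q s \<psi>"
  shows "value_fps (order_polynomial (P <+> Q) (ordinal_sum P r Q s) (ordinal_sum_labeling P \<omega> \<psi>)) =
    (1 - fps_X) * value_fps (order_polynomial P r \<omega>) *
      value_fps (order_polynomial Q s \<psi> :: 'k::field_char_0 poly)"
    (is "?U = _ * ?F * ?G")
proof -
  let ?a = "\<lambda>m. card (labeled_maps P r \<omega> m)" and ?b = "\<lambda>m. card (labeled_maps Q s \<psi> m)"
  let ?u = "\<lambda>m. card (labeled_maps (P <+> Q) (ordinal_sum P r Q s) (ordinal_sum_labeling P \<omega> \<psi>) m)"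
  have U: "?U $ n = of_nat (?u (Suc n))" for n
    by (simp only: value_fps_nth poly_order_polynomial[OF labeled_poset_ordinal_sum[OF P Q]])
  have FG: "(?F * ?G) $ n = of_nat (\<Sum>i\<le>n. ?a (Suc i) * ?b (Suc n - i))" for n
    unfolding fps_mult_nth value_fps_nth poly_order_polynomial[OF P] poly_order_polynomial[OF Q]
      of_nat_sum of_nat_mult
    by (rule sum.cong) (auto simp: Suc_diff_le)
  have "?U + fps_X * (?F * ?G) = ?F * ?G"
  proof (rule fps_ext)
    fix n
    have "(fps_X * (?F * ?G)) $ n = of_nat (\<Sum>i<n. ?a (Suc i) * ?b (n - i))"
      by (cases n) (simp_all add: FG lessThan_Suc_atMost del: of_nat_sum of_nat_mult)
    then show "(?U + fps_X * (?F * ?G)) $ n = (?F * ?G) $ n"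
      unfolding fps_add_nth U FG card_labeled_maps_ordinal_sum[OF P Q, symmetric] by simp
  qed
  then show ?thesis
    by (simp add: algebra_simps eq_diff_eq)
qed

section \<open>Multiplicativity on order polynomials\<close>

theorem lemma3p4:
  fixes scale :: "'k::field_char_0 \<Rightarrow> 'a::comm_ring \<Rightarrow> 'a"
    and L :: "'k poly \<Rightarrow> 'a"
    and P :: "'p set" and r :: "'p rel" and \<omega> :: "'p \<Rightarrow> nat"
    and Q :: "'q set" and s :: "'q rel" and \<psi> :: "'q \<Rightarrow> nat"
  assumes "commutative_algebra scale"
    and "Vector_Spaces.linear smult scale L"
    and "\<And>c d :: nat. L (multichoose_poly (c + d)) = L (multichoose_poly c) * L (multichoose_poly d)"
    and "labeled_poset P r \<omega>"
    and "labeled_poset Q s \<psi>"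
  shows "L (order_polynomial (P <+> Q) (ordinal_sum P r Q s) (ordinal_sum_labeling P \<omega> \<psi>)) =
         L (order_polynomial P r \<omega>) * L (order_polynomial Q s \<psi>)"
  by (rule linear_of_value_fps_product[OF assms(1-3)
        value_fps_order_polynomial_ordinal_sum[OF assms(4,5)]])

end
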